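(* Consider a nonconstant polynomial $p:\mathbb{R}_+^2\to(0,\infty)$ of bi-degree $(2,1)$ given by $p(x,y)=b(x)+a(x)y$, where $a,b$ are real polynomials in one variable. Assume that $\frac1p$ is joint completely monotone. Then: (i) $a$ maps $\mathbb{R}_+$ into $\mathbb{R}_+$, $1\le\deg a\le 2$, and all roots of $a$ are real and nonpositive; (ii) $b$ maps $\mathbb{R}_+$ into $(0,\infty)$, $\deg b=2$, and all roots of $b$ are real and negative. In particular, one of the following possibilities occurs: (a) $p(x,y)=b_0(x+b_1)(x+b_2)+a_0(x+a_1)(x+a_2)y$, (b) $p(x,y)=b_0(x+b_1)(x+b_2)+a_0(x+a_1)y$, where $a_0,b_0,b_1,b_2>0$ and $a_1,a_2\ge 0$.
   Context: $\mathbb{R}_+$ is the set of nonnegative reals. A polynomial $p$ in $(x,y)$ has bi-degree $(\alpha_1,\alpha_2)$ if $\alpha_1$ is its degree in $x$ and $\alpha_2$ its degree in $y$ (the largest integers with $\partial_1^{\alpha_1}p\ne 0$ and $\partial_2^{\alpha_2}p\neq 0$). An infinitely differentiable function $f:\mathbb{R}_+^2\to(0,\infty)$ is joint completely monotone if $(-1)^{i+j}(\partial_1^i\partial_2^jf)(x,y)\ge 0$ for all nonnegative integers $i,j$ and all $x,y\in\mathbb{R}_+$. *)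

theory Defs
  imports "HOL-Analysis.Analysis" "HOL-Computational_Algebra.Computational_Algebra"
begin

text \<open>
  A real polynomial in \<open>(x, y)\<close> is an element of \<open>real poly poly\<close>: the outer variable is \<open>y\<close> and
  the coefficients are polynomials in \<open>x\<close>.
\<close>

definition poly_xy :: "real poly poly \<Rightarrow> real \<Rightarrow> real \<Rightarrow> real" where
  "poly_xy p x y = poly (poly p [:y:]) x"

definition pderiv_x :: "real poly poly \<Rightarrow> real poly poly" where
  "pderiv_x p = map_poly pderiv p"

definition pderiv_y :: "real poly poly \<Rightarrow> real poly poly" where
  "pderiv_y p = pderiv p"

definition has_bidegree :: "real poly poly \<Rightarrow> nat \<Rightarrow> nat \<Rightarrow> bool" where
  "has_bidegree p m n \<longleftrightarrow>
     (pderiv_x ^^ m) p \<noteq> 0 \<and> (\<forall>k>m. (pderiv_x ^^ k) p = 0) \<and>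
     (pderiv_y ^^ n) p \<noteq> 0 \<and> (\<forall>k>n. (pderiv_y ^^ k) p = 0)"

definition quadrant :: "(real \<times> real) set" where
  "quadrant = {0..} \<times> {0..}"

text \<open>
  Partial derivatives of functions on the closed quadrant. They are taken within \<open>{0..}\<close>, so they
  are one-sided on the boundary and depend only on the values of the function on the quadrant.
\<close>

definition partial_x :: "(real \<times> real \<Rightarrow> real) \<Rightarrow> real \<times> real \<Rightarrow> real" where
  "partial_x f = (\<lambda>(x, y). vector_derivative (\<lambda>t. f (t, y)) (at x within {0..}))"

definition partial_y :: "(real \<times> real \<Rightarrow> real) \<Rightarrow> real \<times> real \<Rightarrow> real" where
  "partial_y f = (\<lambda>(x, y). vector_derivative (\<lambda>t. f (x, t)) (at y within {0..}))"

inductive_set iterated_partials :: "(real \<times> real \<Rightarrow> real) \<Rightarrow> (real \<times> real \<Rightarrow> real) set"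
  for f where
  base: "f \<in> iterated_partials f"
| step_x: "g \<in> iterated_partials f \<Longrightarrow> partial_x g \<in> iterated_partials f"
| step_y: "g \<in> iterated_partials f \<Longrightarrow> partial_y g \<in> iterated_partials f"

text \<open>
  Differentiability here is total (Frechet) differentiability relative to the quadrant. Applied to
  every iterated partial derivative, it also makes all of them continuous.
\<close>

definition smooth_on_quadrant :: "(real \<times> real \<Rightarrow> real) \<Rightarrow> bool" where
  "smooth_on_quadrant f \<longleftrightarrow> (\<forall>g \<in> iterated_partials f. g differentiable_on quadrant)"

definition joint_completely_monotone :: "(real \<times> real \<Rightarrow> real) \<Rightarrow> bool" where
  "joint_completely_monotone f \<longleftrightarrow>
     (\<forall>z \<in> quadrant. f z > 0) \<and>
     smooth_on_quadrant f \<and>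
     (\<forall>i j. \<forall>z \<in> quadrant. (-1) ^ (i + j) * (partial_x ^^ i) ((partial_y ^^ j) f) z \<ge> 0)"

end

(*
  For fixed y the x-derivatives of 1/q, where q = b + a y is at most quadratic, satisfy a three-term
  linear recurrence whose characteristic discriminant is that of q. A nonnegative sequence cannot
  satisfy such a recurrence with nonreal characteristic roots, so disc(b + a y) >= 0 for all y >= 0;
  y = 0 and the limit y -> infinity give real roots for b and a, and deg a = 0 is impossible.
  The monotonicity in x of the y-derivatives at y = 0, i.e. of a^j / b^(j+1), forces a to have no
  zero on the half-line (j = 1) and bounds deg a by 3/2 deg b (j = 2), so deg b = 2.
*)
theory Submission
  imports Defs
begin

section \<open>Nonnegative solutions of three-term linear recurrences\<close>

text \<open>If the discriminant were negative, the characteristic polynomial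
  \<open>c0 * t^2 - c1 * t + c2\<close> would be positive everywhere. The ratios of consecutive
  terms would then be positive and decreasing, and their limit would be a real root of that
  polynomial.\<close>

lemma nonneg_recurrence_imp_discriminant_nonneg:
  fixes u :: "nat \<Rightarrow> real" and c0 c1 c2 :: real
  assumes nonneg: "\<And>n. u n \<ge> 0" and "u 0 > 0" and "c0 > 0"
    and start: "c0 * u 1 = c1 * u 0"
    and rec: "\<And>n. c0 * u (n + 2) = c1 * u (n + 1) - c2 * u n"
  shows "4 * c0 * c2 \<le> c1\<^sup>2"
proof (rule ccontr)
  assume "\<not> ?thesis"
  then have disc: "c1\<^sup>2 < 4 * c0 * c2" by simp
  then have "c0 * c2 > 0"
    using zero_le_power2[of c1] by linarith
  then have "c2 > 0"
    using \<open>c0 > 0\<close> by (simp add: zero_less_mult_iff)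
  have pos: "u n > 0" for n
  proof (induction n)
    case (Suc n)
    \<comment> \<open>A zero term after a positive one would force the next term to be negative,
      because \<open>c2 > 0\<close>.\<close>
    have "u (Suc n) \<noteq> 0"
    proof
      assume "u (Suc n) = 0"
      then have "c0 * u (n + 2) < 0"
        using rec[of n] \<open>c2 > 0\<close> Suc by simp
      with nonneg[of "n + 2"] \<open>c0 > 0\<close> show False
        by (simp add: mult_less_0_iff)
    qed
    with nonneg[of "Suc n"] show ?case by simp
  qed (fact \<open>u 0 > 0\<close>)
  define r where "r n = u (Suc n) / u n" for n
  have r_pos: "r n > 0" for n
    by (simp add: r_def pos)
  have r_rec: "c0 * r (Suc n) * r n = c1 * r n - c2" for n
    using rec[of n] pos[of n] pos[of "Suc n"] by (simp add: r_def field_simps)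
  have char_pos: "c0 * t\<^sup>2 - c1 * t + c2 > 0" for t
  proof -
    have "4 * c0 * (c0 * t\<^sup>2 - c1 * t + c2) = (2 * c0 * t - c1)\<^sup>2 + (4 * c0 * c2 - c1\<^sup>2)"
      by (simp add: power2_eq_square algebra_simps)
    also have "\<dots> > 0"
      using disc by (simp add: add_nonneg_pos)
    finally show ?thesis
      using \<open>c0 > 0\<close> by (simp add: zero_less_mult_iff)
  qed
  have "decseq r"
  proof (rule decseq_SucI)
    fix n
    \<comment> \<open>The increment of the ratio, up to the positive factor \<open>c0 * r n\<close>,
      is minus the characteristic polynomial at \<open>r n\<close>.\<close>
    have "c0 * r n * (r (Suc n) - r n) = - (c0 * (r n)\<^sup>2 - c1 * r n + c2)"
      using r_rec[of n] by (simp add: power2_eq_square algebra_simps)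
    then have "c0 * r n * (r (Suc n) - r n) < 0"
      using char_pos[of "r n"] by simp
    then show "r (Suc n) \<le> r n"
      using \<open>c0 > 0\<close> r_pos[of n] by (auto simp: mult_less_0_iff zero_less_mult_iff)
  qed
  then obtain l where l: "r \<longlonglongrightarrow> l"
    using decseq_convergent[of r 0 thesis] r_pos by (auto intro: less_imp_le)
  have "(\<lambda>n. c0 * r (Suc n) * r n) \<longlonglongrightarrow> c0 * l * l"
    by (intro tendsto_intros l LIMSEQ_Suc)
  moreover have "(\<lambda>n. c0 * r (Suc n) * r n) \<longlonglongrightarrow> c1 * l - c2"
    unfolding r_rec by (intro tendsto_intros l)
  ultimately have "c0 * l * l = c1 * l - c2"
    using LIMSEQ_unique by blast
  with char_pos[of l] show False
    by (simp add: power2_eq_square)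
qed

section \<open>Partial derivatives on the closed quadrant\<close>

text \<open>Derivatives within the half-line are unique at every point of it, the end point 0
  included.\<close>

lemma bot_neq_at_within_atLeast: "x \<ge> 0 \<Longrightarrow> at x within {0::real..} \<noteq> bot"
  using at_le[of "{x<..}" "{0..}" x] trivial_limit_at_right_real[of x]
  by (metis atLeast_iff bot_unique greaterThan_iff less_imp_le order_trans subsetI)

text \<open>The total derivative is composed with the embedding of the half-line as a horizontal
  slice of the quadrant.\<close>

lemma partial_x_has_real_derivative:
  assumes "g differentiable_on quadrant" "x \<ge> 0" "y \<ge> 0"
  shows "((\<lambda>t. g (t, y)) has_real_derivative partial_x g (x, y)) (at x within {0..})"
proof -
  have "g differentiable at (x, y) within (\<lambda>t. (t, y)) ` {0..}"
    using assms by (auto simp: differentiable_on_def quadrant_def intro: differentiable_within_subset)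
  moreover have "(\<lambda>t. (t, y)) differentiable at x within {0..}"
    by (auto intro!: derivative_eq_intros simp: differentiable_def)
  ultimately have "(g \<circ> (\<lambda>t. (t, y))) differentiable at x within {0..}"
    by (rule differentiable_chain_within[rotated])
  then show ?thesis
    unfolding partial_x_def has_real_derivative_iff_has_vector_derivative
    by (simp add: vector_derivative_works comp_def)
qed

lemma partial_y_eqI:
  assumes "((\<lambda>t. g (x, t)) has_real_derivative d) (at y within {0..})" "y \<ge> 0"
  shows "partial_y g (x, y) = d"
  using assms unfolding partial_y_def has_real_derivative_iff_has_vector_derivative
  by (auto intro!: vector_derivative_within bot_neq_at_within_atLeast)

lemma iterated_partials_funpow:
  "(partial_x ^^ i) ((partial_y ^^ j) f) \<in> iterated_partials f"
proof -
  have "(partial_y ^^ j) f \<in> iterated_partials f"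
    by (induction j) (auto intro: iterated_partials.intros)
  then show ?thesis
    by (induction i) (auto intro: iterated_partials.intros)
qed

section \<open>Higher derivatives of reciprocals\<close>

text \<open>Derivatives in \<open>y\<close> see only the vertical slice at \<open>x\<close>, so
  \<open>a\<close> and \<open>b\<close> are plain reals here. Each differentiation contributes a
  factor \<open>-(j + 1) * a\<close> and one more power of the denominator.\<close>

lemma reciprocal_affine_partial_y:
  fixes f :: "real \<times> real \<Rightarrow> real"
  assumes f: "\<And>y. y \<ge> 0 \<Longrightarrow> f (x, y) = 1 / (b + a * y)"
    and pos: "\<And>y. y \<ge> 0 \<Longrightarrow> b + a * y > 0"
    and "y \<ge> 0"
  shows "(partial_y ^^ j) f (x, y) = (-1) ^ j * fact j * a ^ j / (b + a * y) ^ Suc j"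
  using \<open>y \<ge> 0\<close>
proof (induction j arbitrary: y)
  case (Suc j)
  have pos': "b + a * y > 0" using pos Suc.prems by simp
  define c d where "c = (-1) ^ j * fact j * a ^ j" and "d = b + a * y"
  have "((\<lambda>t. c / (b + a * t) ^ Suc j) has_real_derivative
      (0 * d ^ Suc j - c * (real (Suc j) * (a * d ^ j))) / (d ^ Suc j * d ^ Suc j))
      (at y within {0..})"
    using pos' unfolding d_def
    by (intro DERIV_quotient derivative_eq_intros refl) auto
  also have "(0 * d ^ Suc j - c * (real (Suc j) * (a * d ^ j))) / (d ^ Suc j * d ^ Suc j) =
      - (c * real (Suc j) * a) / d ^ Suc (Suc j)"
    using pos' by (simp add: d_def[symmetric] divide_simps)
  also have "- (c * real (Suc j) * a) = (-1) ^ Suc j * fact (Suc j) * a ^ Suc j"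
    by (simp add: c_def algebra_simps)
  finally have "((\<lambda>t. (-1) ^ j * fact j * a ^ j / (b + a * t) ^ Suc j) has_real_derivative
      (-1) ^ Suc j * fact (Suc j) * a ^ Suc j / (b + a * y) ^ Suc (Suc j)) (at y within {0..})"
    by (simp only: c_def d_def)
  then have "((\<lambda>t. (partial_y ^^ j) f (x, t)) has_real_derivative
      (-1) ^ Suc j * fact (Suc j) * a ^ Suc j / (b + a * y) ^ Suc (Suc j)) (at y within {0..})"
    \<comment> \<open>The induction hypothesis gives the formula on the whole half-line, so the
      radius 1 is an arbitrary choice.\<close>
    by (rule has_field_derivative_transform_within[where d = 1])
       (use Suc in auto)
  then show ?case
    using Suc.prems by (simp add: partial_y_eqI)
qed (simp add: f)

text \<open>This is the Leibniz rule for the derivatives of the constant \<open>q * D 0 = 1\<close>.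
  Only three terms survive, since the third derivative of \<open>q\<close> vanishes; the last factor
  is the binomial coefficient of \<open>n + 2\<close> over 2.\<close>

lemma reciprocal_quadratic_derivative_recurrence:
  fixes q :: "real poly" and D :: "nat \<Rightarrow> real \<Rightarrow> real"
  assumes "degree q \<le> 2"
    and deriv: "\<And>n x. x \<ge> 0 \<Longrightarrow> (D n has_real_derivative D (Suc n) x) (at x within {0..})"
    and D_0: "\<And>x. x \<ge> 0 \<Longrightarrow> poly q x * D 0 x = 1"
  shows "x \<ge> 0 \<Longrightarrow> poly q x * D 1 x + poly (pderiv q) x * D 0 x = 0"
    and "x \<ge> 0 \<Longrightarrow> poly q x * D (n + 2) x + (real n + 2) * poly (pderiv q) x * D (n + 1) x
      + (real n + 1) * (real n + 2) / 2 * poly (pderiv (pderiv q)) x * D n x = 0"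
proof -
  \<comment> \<open>Differentiating an identity that holds only on the half-line needs uniqueness of
    the one-sided derivative at 0.\<close>
  have zero_deriv: "d = 0"
    if "(h has_real_derivative d) (at x within {0..})" "\<And>t. t \<ge> 0 \<Longrightarrow> h t = c" "x \<ge> 0" for h d c x
  proof -
    have "((\<lambda>t. c) has_real_derivative d) (at x within {0..})"
      by (rule has_field_derivative_transform_within[OF that(1), of 1]) (use that in auto)
    moreover have "((\<lambda>t. c) has_real_derivative 0) (at x within {0..})"
      by (rule DERIV_const)
    ultimately show ?thesis
      using bot_neq_at_within_atLeast[OF \<open>x \<ge> 0\<close>] has_field_derivative_unique by blast
  qed
  have poly_deriv: "(poly r has_real_derivative poly (pderiv r) x) (at x within {0..})" for r x
    by (rule DERIV_subset[OF poly_DERIV]) simp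
  have "degree (pderiv (pderiv q)) = 0"
    using \<open>degree q \<le> 2\<close> by (simp add: degree_pderiv)
  then have third_pderiv: "pderiv (pderiv (pderiv q)) = 0"
    by (simp add: pderiv_eq_0_iff)
  show first: "poly q x * D 1 x + poly (pderiv q) x * D 0 x = 0" if "x \<ge> 0" for x
    by (rule zero_deriv[OF _ D_0 that])
       (use that in \<open>auto intro!: derivative_eq_intros poly_deriv deriv\<close>)
  show "poly q x * D (n + 2) x + (real n + 2) * poly (pderiv q) x * D (n + 1) x
      + (real n + 1) * (real n + 2) / 2 * poly (pderiv (pderiv q)) x * D n x = 0" if "x \<ge> 0"
    using that
  proof (induction n arbitrary: x)
    case 0
    show ?case
      by (rule zero_deriv[OF _ first 0])
         (use 0 in \<open>auto intro!: derivative_eq_intros poly_deriv deriv simp: numeral_2_eq_2 algebra_simps\<close>)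
  next
    case (Suc n)
    \<comment> \<open>Differentiating the identity for \<open>n\<close> gives the one for
      \<open>n + 1\<close>; the coefficients of the second derivative of \<open>q\<close> add up by
      \<open>(n+2) + (n+1)*(n+2)/2 = (n+2)*(n+3)/2\<close>.\<close>
    show ?case
      by (rule zero_deriv[OF _ Suc.IH Suc.prems])
         (use Suc.prems in \<open>auto intro!: derivative_eq_intros poly_deriv deriv
            simp: third_pderiv field_simps\<close>)
  qed
qed

lemma reciprocal_quadratic_discriminant_nonneg:
  fixes q :: "real poly" and D :: "nat \<Rightarrow> real \<Rightarrow> real"
  assumes "degree q \<le> 2" "poly q 0 > 0"
    and deriv: "\<And>n x. x \<ge> 0 \<Longrightarrow> (D n has_real_derivative D (Suc n) x) (at x within {0..})"
    and D_0: "\<And>x. x \<ge> 0 \<Longrightarrow> poly q x * D 0 x = 1"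
    and sign: "\<And>n. (-1) ^ n * D n 0 \<ge> 0"
  shows "4 * coeff q 0 * coeff q 2 \<le> (coeff q 1)\<^sup>2"
proof -
  \<comment> \<open>These are the Taylor coefficients at 0 of \<open>1/q(-x)\<close>. Dividing by
    factorials turns the recurrence into one with constant coefficients, and the sign makes the
    terms nonnegative.\<close>
  define u where "u n = (-1) ^ n * D n 0 / fact n" for n
  note rec = reciprocal_quadratic_derivative_recurrence[OF \<open>degree q \<le> 2\<close> deriv D_0, where x = 0]
  have q_0: "poly q 0 = coeff q 0" "poly (pderiv q) 0 = coeff q 1"
    "poly (pderiv (pderiv q)) 0 = 2 * coeff q 2"
    by (simp_all add: poly_0_coeff_0 coeff_pderiv numeral_2_eq_2)
  show ?thesis
  proof (rule nonneg_recurrence_imp_discriminant_nonneg)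
    show "u n \<ge> 0" for n
      by (simp add: u_def sign)
    show "coeff q 0 > 0"
      using \<open>poly q 0 > 0\<close> by (simp add: q_0)
    then show "u 0 > 0"
      using D_0[of 0] by (simp add: u_def q_0) (metis zero_less_mult_pos zero_less_one)
    show "coeff q 0 * u 1 = coeff q 1 * u 0"
      using rec(1) by (simp add: u_def q_0)
    show "coeff q 0 * u (n + 2) = coeff q 1 * u (n + 1) - coeff q 2 * u n" for n
    proof -
      have fact_2: "fact (n + 2) = (real n + 2) * ((real n + 1) * fact n)"
        and fact_1: "fact (n + 1) = (real n + 1) * fact n"
        by (simp_all add: algebra_simps)
      have "coeff q 0 * D (n + 2) 0 = - (real n + 2) * coeff q 1 * D (n + 1) 0
          - (real n + 1) * (real n + 2) * coeff q 2 * D n 0"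
        using rec(2)[of n] by (simp add: q_0 field_simps)
      then have "coeff q 0 * u (n + 2) = (-1) ^ n * (- (real n + 2) * coeff q 1 * D (n + 1) 0
          - (real n + 1) * (real n + 2) * coeff q 2 * D n 0) / fact (n + 2)"
        by (simp add: u_def)
      also have "\<dots> = coeff q 1 * u (n + 1) - coeff q 2 * u n"
        unfolding u_def fact_2 fact_1 by (simp add: divide_simps) (simp add: algebra_simps)
      finally show ?thesis .
    qed
  qed
qed

section \<open>Degrees, factorisations and roots of polynomials\<close>

lemma degree_1E:
  assumes "degree q = 1"
  obtains d c where "q = [:d, c:]" "c \<noteq> 0"
proof
  show "q = [:coeff q 0, coeff q 1:]"
    using assms by (intro poly_eqI) (auto simp: coeff_pCons coeff_eq_0 split: nat.splits)
  show "coeff q 1 \<noteq> 0"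
    using assms by (metis leading_coeff_0_iff degree_0 zero_neq_one)
qed

text \<open>The bound on the degree in \<open>y\<close> leaves two coefficients, which must be
  \<open>b\<close> and \<open>a\<close>. Derivatives in \<open>x\<close> act on these
  separately.\<close>

lemma has_bidegree_2_1_affine:
  assumes "has_bidegree p 2 1"
    and p_eq: "\<And>x y. poly_xy p x y = poly b x + poly a x * y"
  shows "a \<noteq> 0" "degree a \<le> 2" "degree b \<le> 2" "degree a = 2 \<or> degree b = 2"
proof -
  have "pderiv p \<noteq> 0" "pderiv (pderiv p) = 0"
    using assms(1) unfolding has_bidegree_def pderiv_y_def
    by (auto simp: numeral_2_eq_2 dest: spec[of _ 2])
  then have "degree p = 1"
    by (auto simp: pderiv_eq_0_iff degree_pderiv)
  then obtain b' a' where p: "p = [:b', a':]" "a' \<noteq> 0"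
    by (elim degree_1E)
  have "poly b' x + poly a' x * y = poly b x + poly a x * y" for x y
    using p_eq[of x y] by (simp add: p poly_xy_def algebra_simps)
  \<comment> \<open>The values at \<open>y = 0\<close> identify \<open>b\<close>, and those at
    \<open>y = 1\<close> then identify \<open>a\<close>.\<close>
  from this[of _ 0] this[of _ 1] have "poly b' = poly b" "poly a' = poly a"
    by (auto simp: fun_eq_iff)
  then have [simp]: "b' = b" "a' = a"
    by (simp_all add: poly_eq_poly_eq_iff)
  show "a \<noteq> 0" using p by simp
  have pderiv_x_pCons: "pderiv_x [:u, v:] = [:pderiv u, pderiv v:]" for u v
    by (simp add: pderiv_x_def map_poly_pCons)
  have "(pderiv_x ^^ 2) p \<noteq> 0" "(pderiv_x ^^ 3) p = 0"
    using assms(1) by (auto simp: has_bidegree_def)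
  then have "pderiv (pderiv b) \<noteq> 0 \<or> pderiv (pderiv a) \<noteq> 0"
    "pderiv (pderiv (pderiv b)) = 0" "pderiv (pderiv (pderiv a)) = 0"
    by (auto simp: p pderiv_x_pCons numeral_2_eq_2 numeral_3_eq_3)
  then show "degree a \<le> 2" "degree b \<le> 2" "degree a = 2 \<or> degree b = 2"
    by (auto simp: pderiv_eq_0_iff degree_pderiv)
qed

text \<open>The discriminant condition makes both roots real, and positivity on the half-line forces
  them to be negative.\<close>

lemma poly_pos_degree_2_factor:
  fixes q :: "real poly"
  assumes "degree q = 2" and pos: "\<And>x. x \<ge> 0 \<Longrightarrow> poly q x > 0"
    and disc: "4 * coeff q 0 * coeff q 2 \<le> (coeff q 1)\<^sup>2"
  obtains c r s where "c > 0" "r > 0" "s > 0" "q = smult c ([:r, 1:] * [:s, 1:])"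
proof -
  define c where "c = coeff q 2"
  \<comment> \<open>By the quadratic formula, \<open>r\<close> and \<open>s\<close> below are the
    negatives of the two roots.\<close>
  define \<delta> where "\<delta> = sqrt ((coeff q 1)\<^sup>2 - 4 * coeff q 0 * c)"
  define r where "r = (coeff q 1 - \<delta>) / (2 * c)"
  define s where "s = (coeff q 1 + \<delta>) / (2 * c)"
  have "c \<noteq> 0"
    using \<open>degree q = 2\<close> by (metis c_def degree_0 leading_coeff_0_iff zero_neq_numeral)
  have \<delta>2: "\<delta>\<^sup>2 = (coeff q 1)\<^sup>2 - 4 * coeff q 0 * c"
    using disc by (simp add: \<delta>_def c_def)
  have "c * (r * s) = ((coeff q 1)\<^sup>2 - \<delta>\<^sup>2) / (4 * c)"
    using \<open>c \<noteq> 0\<close> by (simp add: r_def s_def power2_eq_square field_simps)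
  then have "c * (r * s) = coeff q 0"
    using \<open>c \<noteq> 0\<close> by (simp add: \<delta>2)
  moreover have "c * (r + s) = coeff q 1"
    using \<open>c \<noteq> 0\<close> by (simp add: r_def s_def field_simps)
  moreover have "q = [:coeff q 0, coeff q 1, c:]"
    using \<open>degree q = 2\<close> unfolding c_def
    by (intro poly_eqI) (auto simp: coeff_pCons numeral_2_eq_2 coeff_eq_0 split: nat.splits)
  ultimately have q: "q = smult c ([:r, 1:] * [:s, 1:])"
    by (simp add: algebra_simps)
  have "poly q (-r) = 0" "poly q (-s) = 0"
    by (simp_all add: q algebra_simps)
  then have "r > 0" "s > 0"
    using pos[of "-r"] pos[of "-s"] by force+
  moreover have "c > 0"
    using pos[of 0] mult_pos_pos[OF \<open>r > 0\<close> \<open>s > 0\<close>]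
    by (auto simp: q zero_less_mult_iff mult.commute)
  ultimately show ?thesis
    using q that by blast
qed

lemma poly_pos_degree_1_factor:
  fixes q :: "real poly"
  assumes "degree q = 1" and pos: "\<And>x. x \<ge> 0 \<Longrightarrow> poly q x > 0"
  obtains c r where "c > 0" "r > 0" "q = smult c [:r, 1:]"
proof -
  obtain d c where q: "q = [:d, c:]" "c \<noteq> 0"
    using \<open>degree q = 1\<close> by (elim degree_1E)
  have "poly q (- d / c) = 0"
    using q by simp
  then have "d / c > 0"
    using pos[of "- d / c"] by force
  moreover have "c > 0"
    using pos[of 0] \<open>d / c > 0\<close> q by (simp add: zero_less_divide_iff)
  moreover have "q = smult c [:d / c, 1:]"
    using q by simp
  ultimately show ?thesis
    using that by blast
qed

text \<open>Otherwise the square of \<open>a\<close> dominates: the difference has the leading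
  coefficient of \<open>a^2\<close>, which is positive, so it is eventually positive.\<close>

lemma degree_square_le_cube:
  fixes a b :: "real poly"
  assumes le: "\<And>x. x \<ge> 0 \<Longrightarrow> (poly a x)\<^sup>2 \<le> C * poly b x ^ 3"
  shows "2 * degree a \<le> 3 * degree b"
proof (rule ccontr)
  assume not_le: "\<not> ?thesis"
  then have deg: "degree (smult C (b ^ 3)) < degree (a ^ 2)"
    using degree_power_le[of b 3] degree_smult_le[of C "b ^ 3"]
    by (cases "a = 0") (auto simp: degree_power_eq)
  let ?h = "a ^ 2 - smult C (b ^ 3)"
  have "lead_coeff ?h = lead_coeff (a ^ 2)"
    using deg by (metis add.commute diff_conv_add_uminus degree_minus lead_coeff_add_le)
  moreover have "a \<noteq> 0"
    using not_le by auto
  ultimately have "lead_coeff ?h > 0"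
    by (simp add: lead_coeff_power)
  then obtain n where "\<forall>x\<ge>n. lead_coeff ?h \<le> poly ?h x"
    using poly_pinfty_gt_lc by blast
  then have "lead_coeff ?h \<le> poly ?h (max n 0)"
    by simp
  with le[of "max n 0"] \<open>lead_coeff ?h > 0\<close> show False
    by simp
qed

text \<open>This serves as the limit of large \<open>y\<close> in the discriminant inequality, whose
  leading coefficient in \<open>y\<close> is the discriminant of \<open>a\<close>.\<close>

lemma quadratic_nonneg_imp_lead_nonneg:
  fixes \<alpha> \<beta> \<gamma> :: real
  assumes "\<And>y. y \<ge> 0 \<Longrightarrow> \<alpha> + \<beta> * y + \<gamma> * y\<^sup>2 \<ge> 0"
  shows "\<gamma> \<ge> 0"
proof (rule ccontr)
  assume "\<not> ?thesis"
  then have "lead_coeff [:-\<alpha>, -\<beta>, -\<gamma>:] > 0"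
    by simp
  then obtain n where n: "\<forall>y\<ge>n. lead_coeff [:-\<alpha>, -\<beta>, -\<gamma>:] \<le> poly [:-\<alpha>, -\<beta>, -\<gamma>:] y"
    using poly_pinfty_gt_lc by blast
  have "poly [:-\<alpha>, -\<beta>, -\<gamma>:] (max n 0) > 0"
    using n \<open>_ > 0\<close> by (meson less_le_trans max.cobounded1)
  with assms[of "max n 0"] show False
    by (simp add: power2_eq_square algebra_simps)
qed

text \<open>Reality of all roots is a claim about complex roots, so the real factorisation is
  carried over to the complex numbers.\<close>

lemma complex_roots_of_split_quadratic:
  fixes c r s :: real
  assumes "poly (map_poly complex_of_real (smult c ([:r, 1:] * [:s, 1:]))) z = 0" "c \<noteq> 0"
  shows "z = complex_of_real (- r) \<or> z = complex_of_real (- s)"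
proof -
  have "complex_of_real c * ((z + complex_of_real r) * (z + complex_of_real s)) = 0"
    using assms(1) by (simp add: map_poly_pCons algebra_simps)
  then show ?thesis
    using \<open>c \<noteq> 0\<close> by (auto simp: eq_neg_iff_add_eq_0)
qed

lemma complex_root_of_linear:
  fixes c r :: real
  assumes "poly (map_poly complex_of_real (smult c [:r, 1:])) z = 0" "c \<noteq> 0"
  shows "z = complex_of_real (- r)"
proof -
  have "complex_of_real c * (z + complex_of_real r) = 0"
    using assms(1) by (simp add: map_poly_pCons algebra_simps)
  then show ?thesis
    using \<open>c \<noteq> 0\<close> by (auto simp: eq_neg_iff_add_eq_0)
qed

section \<open>Consequences of joint complete monotonicity\<close>

lemma joint_completely_monotone_partial_x_derivative:
  assumes "joint_completely_monotone f" "x \<ge> 0" "y \<ge> 0"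
  shows "((\<lambda>t. (partial_x ^^ i) ((partial_y ^^ j) f) (t, y)) has_real_derivative
    (partial_x ^^ Suc i) ((partial_y ^^ j) f) (x, y)) (at x within {0..})"
proof -
  have "(partial_x ^^ i) ((partial_y ^^ j) f) differentiable_on quadrant"
    using assms(1) iterated_partials_funpow
    by (auto simp: joint_completely_monotone_def smooth_on_quadrant_def)
  from partial_x_has_real_derivative[OF this assms(2,3)] show ?thesis
    by simp
qed

text \<open>The sign condition with exactly one derivative in \<open>x\<close> says that the slope
  of this function is nonpositive.\<close>

lemma joint_completely_monotone_antimono:
  assumes f: "joint_completely_monotone f" and "0 \<le> s" "s \<le> t" "0 \<le> y"
  shows "(-1) ^ j * (partial_y ^^ j) f (t, y) \<le> (-1) ^ j * (partial_y ^^ j) f (s, y)"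
proof -
  define h where "h x = (-1) ^ j * (partial_y ^^ j) f (x, y)" for x
  define h' where "h' x = (-1) ^ j * partial_x ((partial_y ^^ j) f) (x, y)" for x
  have deriv: "(h has_real_derivative h' x) (at x within {0..})" if "x \<ge> 0" for x
    using joint_completely_monotone_partial_x_derivative[OF f that \<open>0 \<le> y\<close>, of 0 j]
    unfolding h_def h'_def by (auto intro: DERIV_cmult)
  have "h t \<le> h s"
  proof (rule DERIV_nonpos_imp_decreasing_open[OF \<open>s \<le> t\<close>])
    fix x assume "s < x" "x < t"
    then have "x > 0" using \<open>0 \<le> s\<close> by simp
    have "(-1) ^ (1 + j) * (partial_x ^^ 1) ((partial_y ^^ j) f) (x, y) \<ge> 0"
      using f \<open>x > 0\<close> \<open>0 \<le> y\<close>
      unfolding joint_completely_monotone_def quadrant_def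
      by (metis SigmaI atLeast_iff less_imp_le)
    then have "h' x \<le> 0"
      by (simp add: h'_def)
    \<comment> \<open>At interior points the one-sided derivative is two-sided; the end points of
      the interval enter only through continuity.\<close>
    moreover have "at x within {0..} = at x"
      using \<open>x > 0\<close> by (intro at_within_interior) simp
    ultimately show "\<exists>d. (h has_real_derivative d) (at x) \<and> d \<le> 0"
      using deriv[of x] \<open>x > 0\<close> by auto
  next
    have "continuous_on {0..} h"
      using deriv by (intro DERIV_continuous_on) auto
    then show "continuous_on {s..t} h"
      by (rule continuous_on_subset) (use \<open>0 \<le> s\<close> in auto)
  qed
  then show ?thesis
    by (simp add: h_def)
qed

section \<open>Restrictions on \<open>a\<close> and \<open>b\<close> from the sign
  conditions\<close>

theorem proposition3p2:
  fixes p :: "real poly poly" and a b :: "real poly"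
  assumes nonconstant: "\<nexists>c. \<forall>x y. poly_xy p x y = c"
    and positive: "\<And>x y. x \<ge> 0 \<Longrightarrow> y \<ge> 0 \<Longrightarrow> poly_xy p x y > 0"
    and bidegree: "has_bidegree p 2 1"
    and p_eq: "\<And>x y. poly_xy p x y = poly b x + poly a x * y"
    and jcm: "joint_completely_monotone (\<lambda>(x, y). 1 / poly_xy p x y)"
  shows
    "((\<forall>x\<ge>0. poly a x \<ge> 0) \<and> 1 \<le> degree a \<and> degree a \<le> 2 \<and>
       (\<forall>z. poly (map_poly complex_of_real a) z = 0 \<longrightarrow> z \<in> \<real> \<and> Re z \<le> 0)) \<and>
     ((\<forall>x\<ge>0. poly b x > 0) \<and> degree b = 2 \<and>
       (\<forall>z. poly (map_poly complex_of_real b) z = 0 \<longrightarrow> z \<in> \<real> \<and> Re z < 0)) \<and>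
     (\<exists>a0 b0 b1 b2 a1 a2 :: real.
        a0 > 0 \<and> b0 > 0 \<and> b1 > 0 \<and> b2 > 0 \<and> a1 \<ge> 0 \<and> a2 \<ge> 0 \<and>
        ((\<forall>x y. poly_xy p x y = b0 * (x + b1) * (x + b2) + a0 * (x + a1) * (x + a2) * y) \<or>
         (\<forall>x y. poly_xy p x y = b0 * (x + b1) * (x + b2) + a0 * (x + a1) * y)))"
proof -
  note a_nz = has_bidegree_2_1_affine(1)[OF bidegree p_eq]
    and deg_le = has_bidegree_2_1_affine(2,3)[OF bidegree p_eq]
    and deg_2 = has_bidegree_2_1_affine(4)[OF bidegree p_eq]
  define f where "f = (\<lambda>(x, y). 1 / poly_xy p x y)"
  have f: "f (x, y) = 1 / (poly b x + poly a x * y)" for x y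
    by (simp add: f_def p_eq)
  have jcm_f: "joint_completely_monotone f"
    using jcm by (simp add: f_def)
  have pos: "poly b x + poly a x * y > 0" if "x \<ge> 0" "y \<ge> 0" for x y
    using positive[OF that] by (simp add: p_eq)
  have b_pos: "poly b x > 0" if "x \<ge> 0" for x
    using pos[OF that, of 0] by simp

  \<comment> \<open>For fixed \<open>y\<close>, the sign conditions on the pure
    \<open>x\<close>-derivatives at \<open>x = 0\<close> apply to the quadratic
    \<open>b + y * a\<close>.\<close>
  have disc: "4 * (coeff b 0 + coeff a 0 * y) * (coeff b 2 + coeff a 2 * y)
      \<le> (coeff b 1 + coeff a 1 * y)\<^sup>2" if "y \<ge> 0" for y
  proof -
    have "4 * coeff (b + smult y a) 0 * coeff (b + smult y a) 2 \<le> (coeff (b + smult y a) 1)\<^sup>2"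
    proof (rule reciprocal_quadratic_discriminant_nonneg[where D = "\<lambda>n x. (partial_x ^^ n) f (x, y)"])
      show "degree (b + smult y a) \<le> 2"
        using deg_le by (intro degree_add_le order.trans[OF degree_smult_le])
      show "poly (b + smult y a) 0 > 0"
        using pos[of 0 y] that by (simp add: mult.commute)
      show "((\<lambda>x. (partial_x ^^ n) f (x, y)) has_real_derivative (partial_x ^^ Suc n) f (x, y))
          (at x within {0..})" if "x \<ge> 0" for n x
        using joint_completely_monotone_partial_x_derivative[OF jcm_f that \<open>y \<ge> 0\<close>, of n 0] by simp
      show "poly (b + smult y a) x * (partial_x ^^ 0) f (x, y) = 1" if "x \<ge> 0" for x
        using pos[OF that \<open>y \<ge> 0\<close>] by (simp add: f mult.commute)
      show "(-1) ^ n * (partial_x ^^ n) f (0, y) \<ge> 0" for n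
      proof -
        have "(-1) ^ (n + 0) * (partial_x ^^ n) ((partial_y ^^ 0) f) (0, y) \<ge> 0"
          using jcm_f \<open>y \<ge> 0\<close> unfolding joint_completely_monotone_def quadrant_def
          by (metis SigmaI atLeast_iff order_refl)
        then show ?thesis by simp
      qed
    qed
    then show ?thesis
      by (simp add: mult.commute)
  qed

  \<comment> \<open>Up to the factor \<open>fact j\<close>, these quotients are the signed
    \<open>y\<close>-derivatives of order \<open>j\<close> at \<open>y = 0\<close>.\<close>
  have antimono: "poly a t ^ j / poly b t ^ Suc j \<le> poly a s ^ j / poly b s ^ Suc j"
    if "0 \<le> s" "s \<le> t" for s t j
  proof -
    have "(-1) ^ j * (partial_y ^^ j) f (x, 0) = fact j * (poly a x ^ j / poly b x ^ Suc j)"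
      if "x \<ge> 0" for x
      using reciprocal_affine_partial_y[of f x "poly b x" "poly a x" 0 j] pos that
      by (simp add: f flip: power_mult_distrib mult.assoc)
    then show ?thesis
      using joint_completely_monotone_antimono[OF jcm_f that order_refl, of j] that
      by (simp del: times_divide_eq_right)
  qed

  have a_nonneg: "poly a x \<ge> 0" if "x \<ge> 0" for x
  proof (rule ccontr)
    assume "\<not> ?thesis"
    \<comment> \<open>A negative value of \<open>a\<close> would give \<open>p\<close> a zero at a
      nonnegative \<open>y\<close>.\<close>
    then have "poly b x + poly a x * (- poly b x / poly a x) = 0" "- poly b x / poly a x \<ge> 0"
      using b_pos[OF that] by (auto simp: field_simps)
    with pos[OF that, of "- poly b x / poly a x"] show False
      by simp
  qed
  have a_pos: "poly a x > 0" if "x \<ge> 0" for x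
  proof (rule ccontr)
    assume "\<not> ?thesis"
    then have "poly a x = 0"
      using a_nonneg[OF that] by simp
    \<comment> \<open>By the case \<open>j = 1\<close>, \<open>a / b^2\<close> is nonincreasing and
      nonnegative, so a zero of \<open>a\<close> persists to the right. A nonzero polynomial has
      only finitely many zeros.\<close>
    have "poly a t = 0" if "t \<ge> x" for t
    proof -
      have "poly a t / (poly b t)\<^sup>2 \<le> 0"
        using antimono[OF \<open>x \<ge> 0\<close> that, of 1] \<open>poly a x = 0\<close> by (simp add: power2_eq_square)
      then show ?thesis
        using a_nonneg[of t] b_pos[of t] that \<open>x \<ge> 0\<close> by (auto simp: divide_le_0_iff)
    qed
    then have "{x..} \<subseteq> {t. poly a t = 0}"
      by auto
    then show False
      using poly_roots_finite[OF a_nz] infinite_Ici finite_subset by blast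
  qed

  have deg_b: "degree b = 2"
  proof -
    \<comment> \<open>The case \<open>j = 2\<close> bounds \<open>a^2 / b^3\<close> by its value at
      0. The degree inequality then rules out \<open>degree a = 2\<close> with
      \<open>degree b <= 1\<close>.\<close>
    define C where "C = (poly a 0)\<^sup>2 / poly b 0 ^ 3"
    have "(poly a x)\<^sup>2 \<le> C * poly b x ^ 3" if "x \<ge> 0" for x
      using antimono[OF order_refl that, of 2] b_pos[OF that]
      by (simp add: C_def field_simps numeral_3_eq_3 numeral_2_eq_2)
    then have "2 * degree a \<le> 3 * degree b"
      by (rule degree_square_le_cube)
    then show ?thesis
      using deg_2 deg_le by auto
  qed
  obtain b0 b1 b2 where b: "b0 > 0" "b1 > 0" "b2 > 0" "b = smult b0 ([:b1, 1:] * [:b2, 1:])"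
    using poly_pos_degree_2_factor[OF deg_b b_pos] disc[of 0] by auto
  have b_roots: "z \<in> \<real> \<and> Re z < 0" if "poly (map_poly complex_of_real b) z = 0" for z
    using complex_roots_of_split_quadratic[of b0 b1 b2 z] that b by auto

  have deg_a: "degree a \<ge> 1"
  proof (rule ccontr)
    assume "\<not> ?thesis"
    then have "degree a = 0" by simp
    then obtain c where a: "a = [:c:]"
      by (rule degree_eq_zeroE)
    then have "c > 0"
      using a_pos[of 0] by simp
    have b_2: "coeff b 2 > 0"
      using b by (simp add: numeral_2_eq_2)
    \<comment> \<open>At this \<open>y\<close> the term \<open>4 * c * y * coeff b 2\<close> equals
      the square of \<open>coeff b 1\<close>, so the discriminant of \<open>b + c * y\<close> is
      \<open>-4 * coeff b 0 * coeff b 2\<close>, which is negative.\<close>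
    define y where "y = (coeff b 1)\<^sup>2 / (4 * c * coeff b 2)"
    have "coeff b 0 > 0"
      using b_pos[of 0] by (simp add: poly_0_coeff_0)
    have "4 * (coeff b 0 + c * y) * coeff b 2 \<le> (coeff b 1)\<^sup>2"
      using disc[of y] \<open>c > 0\<close> b_2 by (simp add: a y_def numeral_2_eq_2)
    moreover have "4 * c * y * coeff b 2 = (coeff b 1)\<^sup>2"
      using \<open>c > 0\<close> b_2 by (simp add: y_def)
    moreover have "coeff b 0 * coeff b 2 > 0"
      using b_2 \<open>coeff b 0 > 0\<close> by simp
    ultimately show False
      by (simp add: algebra_simps)
  qed

  have disc_a: "4 * coeff a 0 * coeff a 2 \<le> (coeff a 1)\<^sup>2"
  proof -
    have "(coeff a 1)\<^sup>2 - 4 * coeff a 0 * coeff a 2 \<ge> 0"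
    proof (rule quadratic_nonneg_imp_lead_nonneg)
      \<comment> \<open>The discriminant of \<open>b + y * a\<close> is expanded in powers of
        \<open>y\<close>.\<close>
      show "((coeff b 1)\<^sup>2 - 4 * coeff b 0 * coeff b 2)
          + (2 * coeff a 1 * coeff b 1 - 4 * coeff a 0 * coeff b 2 - 4 * coeff b 0 * coeff a 2) * y
          + ((coeff a 1)\<^sup>2 - 4 * coeff a 0 * coeff a 2) * y\<^sup>2 \<ge> 0" if "y \<ge> 0" for y
        using disc[OF that] by (simp add: power2_eq_square algebra_simps)
    qed
    then show ?thesis by simp
  qed

  have "(\<forall>z. poly (map_poly complex_of_real a) z = 0 \<longrightarrow> z \<in> \<real> \<and> Re z \<le> 0) \<and>
    (\<exists>a0 a1 a2. a0 > 0 \<and> a1 \<ge> 0 \<and> a2 \<ge> 0 \<and>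
      (a = smult a0 ([:a1, 1:] * [:a2, 1:]) \<or> a = smult a0 [:a1, 1:]))"
  proof (cases "degree a = 2")
    case True
    then obtain a0 a1 a2 where
      a: "a0 > 0" "a1 > 0" "a2 > 0" "a = smult a0 ([:a1, 1:] * [:a2, 1:])"
      using poly_pos_degree_2_factor[OF True a_pos disc_a] by auto
    have "z \<in> \<real> \<and> Re z \<le> 0" if "poly (map_poly complex_of_real a) z = 0" for z
      using complex_roots_of_split_quadratic[of a0 a1 a2 z] that a by auto
    moreover have "a1 \<ge> 0" "a2 \<ge> 0"
      using a by simp_all
    ultimately show ?thesis
      using a(1,4) by blast
  next
    case False
    then have "degree a = 1"
      using deg_a deg_le by simp
    then obtain a0 a1 where a: "a0 > 0" "a1 > 0" "a = smult a0 [:a1, 1:]"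
      using poly_pos_degree_1_factor[OF _ a_pos] by blast
    have "z \<in> \<real> \<and> Re z \<le> 0" if "poly (map_poly complex_of_real a) z = 0" for z
      using complex_root_of_linear[of a0 a1 z] that a by auto
    moreover have "a1 \<ge> 0"
      using a by simp
    \<comment> \<open>The linear factorisation does not involve \<open>a2\<close>, so any
      nonnegative value is a witness.\<close>
    ultimately show ?thesis
      using a(1,3) by blast
  qed
  then obtain a0 a1 a2 where
    a_roots: "\<And>z. poly (map_poly complex_of_real a) z = 0 \<Longrightarrow> z \<in> \<real> \<and> Re z \<le> 0"
    and a: "a0 > 0" "a1 \<ge> 0" "a2 \<ge> 0"
      "a = smult a0 ([:a1, 1:] * [:a2, 1:]) \<or> a = smult a0 [:a1, 1:]"
    by blast
  have "poly b x = b0 * (x + b1) * (x + b2)" for x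
    by (simp add: b(4) algebra_simps)
  moreover have "(\<forall>x. poly a x = a0 * (x + a1) * (x + a2)) \<or> (\<forall>x. poly a x = a0 * (x + a1))"
    using a(4) by (auto simp: algebra_simps)
  ultimately have "(\<forall>x y. poly_xy p x y = b0 * (x + b1) * (x + b2) + a0 * (x + a1) * (x + a2) * y) \<or>
      (\<forall>x y. poly_xy p x y = b0 * (x + b1) * (x + b2) + a0 * (x + a1) * y)"
    by (auto simp: p_eq)
  with a b have "\<exists>a0 b0 b1 b2 a1 a2 :: real.
        a0 > 0 \<and> b0 > 0 \<and> b1 > 0 \<and> b2 > 0 \<and> a1 \<ge> 0 \<and> a2 \<ge> 0 \<and>
        ((\<forall>x y. poly_xy p x y = b0 * (x + b1) * (x + b2) + a0 * (x + a1) * (x + a2) * y) \<or>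
         (\<forall>x y. poly_xy p x y = b0 * (x + b1) * (x + b2) + a0 * (x + a1) * y))"
    by meson
  then show ?thesis
    using a_nonneg b_pos deg_a deg_le deg_b a_roots b_roots by blast
qed

end
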